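(* The polynomial $p(x_1,x_2;z_1,z_2)=x_1^2-2x_2^2+z_1^2-z_2^2$ is partition regular over $\mathbb{Z}\big[\frac{1+\sqrt{-3}}{2}\big]$ with respect to $x_1$ and $x_2$.
   Context: Let $K$ be a number field with ring of integers $\mathcal{O}_K$ and let $p\in\mathbb{C}[x_1,\dots,x_s;z_1,\dots,z_r]$. The polynomial $p$ is partition regular over $\mathcal{O}_K$ with respect to $x_1,\dots,x_s$ if for every finite partition $\mathcal{O}_K=\bigcup_{i=1}^mU_i$ there exist $1\le i\le m$ and non-zero, pairwise distinct $x_1,\dots,x_s\in U_i$ such that $p(x_1,\dots,x_s;z_1,\dots,z_r)=0$ for some $z_1,\dots,z_r\in\mathcal{O}_K$. Here $\mathbb{Z}[\frac{1+\sqrt{-3}}{2}]$ is the ring of integers of $\mathbb{Q}(\sqrt{-3})$. *)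

theory Defs
  imports
    Complex_Main
    "HOL-Library.Poly_Mapping"
    "HOL-Library.Disjoint_Sets"
    "HOL-Computational_Algebra.Computational_Algebra"
begin

text \<open>
  The polynomial ring with complex coefficients in the variables \<open>x\<^sub>1, x\<^sub>2, \<dots>\<close> and
  \<open>z\<^sub>1, z\<^sub>2, \<dots>\<close>: a polynomial is a finitely supported map from monomials to coefficients, a
  monomial a finitely supported map from variables to exponents. Addition and multiplication
  are those of \<^theory>\<open>HOL-Library.Poly_Mapping\<close>.
\<close>

datatype var = X nat | Z nat

type_synonym cpoly = "(var \<Rightarrow>\<^sub>0 nat) \<Rightarrow>\<^sub>0 complex"

definition PVar :: "var \<Rightarrow> cpoly" where
  "PVar v = Poly_Mapping.single (Poly_Mapping.single v 1) 1"

definition pvars :: "cpoly \<Rightarrow> var set" where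
  "pvars p = (\<Union>m\<in>Poly_Mapping.keys p. Poly_Mapping.keys m)"

definition cpoly_ring :: "nat \<Rightarrow> nat \<Rightarrow> cpoly set" where
  "cpoly_ring s r = {p. pvars p \<subseteq> X ` {1..s} \<union> Z ` {1..r}}"

definition peval :: "(nat \<Rightarrow> complex) \<Rightarrow> (nat \<Rightarrow> complex) \<Rightarrow> cpoly \<Rightarrow> complex" where
  "peval x z p =
    (\<Sum>m\<in>Poly_Mapping.keys p. Poly_Mapping.lookup p m *
      (\<Prod>v\<in>Poly_Mapping.keys m. case_var x z v ^ Poly_Mapping.lookup m v))"

text \<open>
  Here \<open>R\<close> is meant to be the ring of integers of a number field embedded in the complex
  numbers, and \<open>p\<close> a polynomial in \<open>x\<^sub>1, \<dots>, x\<^sub>s; z\<^sub>1, \<dots>, z\<^sub>r\<close>. The regularity is with respect to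
  \<open>x\<^sub>1, \<dots>, x\<^sub>s\<close>: these are distinct, non-zero and in the same cell, whereas \<open>z\<^sub>1, \<dots>, z\<^sub>r\<close> are
  arbitrary elements of \<open>R\<close>. The values of \<open>x\<close> and \<open>z\<close> at other indices do not matter.
\<close>

definition partition_regular_over :: "complex set \<Rightarrow> nat \<Rightarrow> nat \<Rightarrow> cpoly \<Rightarrow> bool" where
  "partition_regular_over R s r p \<longleftrightarrow>
     p \<in> cpoly_ring s r \<and>
     (\<forall>P. finite P \<and> partition_on R P \<longrightarrow>
        (\<exists>U\<in>P. \<exists>x z.
           (\<forall>i\<in>{1..s}. x i \<in> U \<and> x i \<noteq> 0) \<and> inj_on x {1..s} \<and>
           (\<forall>j\<in>{1..r}. z j \<in> R) \<and>
           peval x z p = 0))"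

text \<open>\<open>\<int>[\<alpha>]\<close>, the smallest subring of the complex numbers containing \<open>\<alpha>\<close>.\<close>

definition int_adjoin :: "complex \<Rightarrow> complex set" where
  "int_adjoin \<alpha> = range (\<lambda>f :: int poly. poly (map_poly of_int f) \<alpha>)"

text \<open>Evaluation is a ring homomorphism.\<close>

lemma peval_superset:
  assumes "finite A" "Poly_Mapping.keys p \<subseteq> A"
  shows "peval x z p =
    (\<Sum>m\<in>A. Poly_Mapping.lookup p m *
      (\<Prod>v\<in>Poly_Mapping.keys m. case_var x z v ^ Poly_Mapping.lookup m v))"
  unfolding peval_def using assms
  by (intro sum.mono_neutral_left) (auto simp: in_keys_iff)

lemma peval_add: "peval x z (p + q) = peval x z p + peval x z q"
proof -
  let ?A = "Poly_Mapping.keys p \<union> Poly_Mapping.keys q"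
  have "Poly_Mapping.keys (p + q) \<subseteq> ?A" by (rule Poly_Mapping.keys_add)
  then show ?thesis
    by (simp add: peval_superset[of ?A] lookup_add distrib_right sum.distrib)
qed

lemma peval_zero: "peval x z 0 = 0"
  by (simp add: peval_def)

lemma peval_uminus: "peval x z (- p) = - peval x z p"
  using peval_add[of x z p "- p"] by (simp add: peval_zero add_eq_0_iff)

lemma peval_diff: "peval x z (p - q) = peval x z p - peval x z q"
  using peval_add[of x z p "- q"] by (simp add: peval_uminus)

lemma peval_single:
  "peval x z (Poly_Mapping.single m c) =
    c * (\<Prod>v\<in>Poly_Mapping.keys m. case_var x z v ^ Poly_Mapping.lookup m v)"
  by (subst peval_superset[of "{m}"]) auto

lemma peval_mult_single:
  "peval x z (Poly_Mapping.single m c * Poly_Mapping.single n d) =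
    peval x z (Poly_Mapping.single m c) * peval x z (Poly_Mapping.single n d)"
proof -
  let ?A = "Poly_Mapping.keys m \<union> Poly_Mapping.keys n"
  have *: "(\<Prod>v\<in>Poly_Mapping.keys k. case_var x z v ^ Poly_Mapping.lookup k v) =
      (\<Prod>v\<in>?A. case_var x z v ^ Poly_Mapping.lookup k v)"
    if "Poly_Mapping.keys k \<subseteq> ?A" for k
    using that by (intro prod.mono_neutral_left) (auto simp: in_keys_iff)
  have "peval x z (Poly_Mapping.single m c * Poly_Mapping.single n d) =
      c * d * (\<Prod>v\<in>?A. case_var x z v ^ Poly_Mapping.lookup (m + n) v)"
    by (simp only: mult_single peval_single *[OF Poly_Mapping.keys_add])
  also have "\<dots> = c * (\<Prod>v\<in>?A. case_var x z v ^ Poly_Mapping.lookup m v) *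
      (d * (\<Prod>v\<in>?A. case_var x z v ^ Poly_Mapping.lookup n v))"
    by (simp add: lookup_add power_add prod.distrib)
  also have "\<dots> = peval x z (Poly_Mapping.single m c) * peval x z (Poly_Mapping.single n d)"
    by (simp only: peval_single *[of m] *[of n] Un_upper1 Un_upper2)
  finally show ?thesis .
qed

lemma cpoly_induct [case_names zero add]:
  fixes p :: cpoly
  assumes "Q 0" and "\<And>p m c. Q p \<Longrightarrow> Q (Poly_Mapping.single m c + p)"
  shows "Q p"
proof -
  have "Q (\<Sum>m\<in>A. Poly_Mapping.single m (Poly_Mapping.lookup p m))" if "finite A" for A
    using that by (induction A) (auto intro: assms)
  moreover have "p = (\<Sum>m\<in>Poly_Mapping.keys p. Poly_Mapping.single m (Poly_Mapping.lookup p m))"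
    by (rule poly_mapping_eqI)
      (auto simp: lookup_sum lookup_single when_def sum.delta in_keys_iff)
  ultimately show ?thesis
    using finite_keys[of p] by metis
qed

lemma peval_mult: "peval x z (p * q) = peval x z p * peval x z q"
proof (induction p rule: cpoly_induct)
  case zero
  then show ?case by (simp add: peval_zero)
next
  case (add p m c)
  have "peval x z (Poly_Mapping.single m c * q) = peval x z (Poly_Mapping.single m c) * peval x z q"
    by (induction q rule: cpoly_induct)
      (auto simp: peval_zero peval_add distrib_left peval_mult_single)
  with add show ?case
    by (simp add: peval_add distrib_right)
qed

lemma peval_one: "peval x z 1 = 1"
  using peval_single[of x z 0 1] by simp

lemma peval_power: "peval x z (p ^ n) = peval x z p ^ n"
  by (induction n) (auto simp: peval_one peval_mult)

lemma peval_numeral: "peval x z (numeral k) = numeral k"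
proof -
  have "peval x z (of_nat n) = of_nat n" for n
    by (induction n) (auto simp: peval_zero peval_one peval_add)
  from this[of "numeral k"] show ?thesis by simp
qed

lemma peval_PVar: "peval x z (PVar v) = case_var x z v"
  by (simp add: PVar_def peval_single)

lemmas peval_simps =
  peval_add peval_diff peval_uminus peval_mult peval_power peval_numeral
  peval_zero peval_one peval_PVar

text \<open>\<open>\<int>[(1 + \<surd>-3) / 2]\<close> is the ring of integers of \<open>\<rat>(\<surd>-3)\<close>.\<close>

lemma csqrt_minus3: "csqrt (-3) = \<i> * of_real (sqrt 3)"
  by simp

lemma int_adjoin_eisenstein:
  "int_adjoin ((1 + csqrt (-3)) / 2) =
    {of_int m + of_int n * ((1 + csqrt (-3)) / 2) | m n. True}" (is "_ = ?B")
proof (intro equalityI subsetI)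
  define w where "w = (1 + csqrt (-3)) / 2"
  have w2: "w * w = w - 1"
  proof -
    define t where "t = csqrt (-3)"
    have "t * t = -3" unfolding t_def by (metis power2_csqrt power2_eq_square)
    then show ?thesis unfolding w_def t_def[symmetric] by (simp add: field_simps)
  qed
  {
    fix f :: "int poly"
    have "\<exists>m n. poly (map_poly of_int f) w = of_int m + of_int n * w"
    proof (induction f)
      case 0
      then show ?case by (auto intro!: exI[of _ 0])
    next
      case (pCons a f)
      then obtain m n where *: "poly (map_poly of_int f) w = of_int m + of_int n * w" by blast
      have "poly (map_poly of_int (pCons a f)) w = of_int a + w * (of_int m + of_int n * w)"
        by (simp add: map_poly_pCons *)
      also have "\<dots> = of_int a + of_int m * w + of_int n * (w * w)" by (simp add: algebra_simps)
      also have "\<dots> = of_int (a - n) + of_int (m + n) * w" by (simp add: w2 algebra_simps)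
      finally show ?case by blast
    qed
  }
  then show "x \<in> ?B" if "x \<in> int_adjoin ((1 + csqrt (-3)) / 2)" for x
    using that unfolding int_adjoin_def w_def by auto
  show "x \<in> int_adjoin ((1 + csqrt (-3)) / 2)" if "x \<in> ?B" for x
  proof -
    from that obtain m n where "x = of_int m + of_int n * w" unfolding w_def by auto
    then have "x = poly (map_poly of_int [:m, n:]) w" by (simp add: map_poly_pCons)
    then show ?thesis unfolding int_adjoin_def w_def by blast
  qed
qed

lemma nonreal_linear_zero:
  fixes r :: "int poly"
  assumes "degree r < 2" "poly (map_poly of_int r) x = 0" "Im x \<noteq> 0"
  shows "r = 0"
proof -
  obtain a q where r: "r = pCons a q" by (cases r)
  with assms(1) have "degree q = 0" by (auto split: if_splits)
  then obtain b where q: "q = [:b:]" by (elim degree_eq_zeroE)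
  have *: "of_int a + x * of_int b = 0"
    using assms(2) by (simp add: r q map_poly_pCons)
  have "b = 0" using arg_cong[OF *, of Im] assms(3) by simp
  with * show ?thesis by (simp add: r q)
qed

lemma poly_of_int_add:
  fixes x :: complex
  shows "poly (map_poly of_int (p + q)) x = poly (map_poly of_int p) x + poly (map_poly of_int q) x"
proof (induction p q rule: poly_induct2)
  case (pCons a p b q)
  then show ?case by (simp add: map_poly_pCons algebra_simps)
qed simp

lemma poly_of_int_smult:
  fixes x :: complex
  shows "poly (map_poly of_int (smult c p)) x = of_int c * poly (map_poly of_int p) x"
  by (induction p) (auto simp: map_poly_pCons algebra_simps)

lemma poly_of_int_mult:
  fixes x :: complex
  shows "poly (map_poly of_int (p * q)) x = poly (map_poly of_int p) x * poly (map_poly of_int q) x"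
  by (induction p)
    (auto simp: map_poly_pCons poly_of_int_add poly_of_int_smult algebra_simps)

lemma algebraic_int_quadratic:
  fixes d e g :: int
  assumes "algebraic_int (x :: complex)" "Im x \<noteq> 0" "d > 0"
    and root: "of_int d * x\<^sup>2 + of_int e * x + of_int g = 0" and prim: "content [:g, e, d:] = 1"
  shows "d = 1"
proof -
  define q where "q = [:g, e, d:]"
  have q: "q \<noteq> 0" "degree q = 2" "lead_coeff q = d" "content q = 1"
    using assms(3) prim by (auto simp: q_def)
  have q0: "poly (map_poly of_int q) x = 0"
    using root by (simp add: q_def map_poly_pCons algebra_simps power2_eq_square)
  from assms(1) obtain f :: "int poly"
    where f: "poly (map_poly of_int f) x = 0" "lead_coeff f = 1"
    using algebraic_int_altdef_ipoly by blast
  obtain s r where sr: "pseudo_divmod f q = (s, r)" by fastforce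
  define k where "k = Suc (degree f) - degree q"
  have eq: "smult (d ^ k) f = q * s + r" and deg: "r = 0 \<or> degree r < 2"
    using pseudo_divmod[OF q(1) sr] q unfolding k_def by auto
  have "poly (map_poly of_int r) x = 0"
    using arg_cong[OF eq, of "\<lambda>p. poly (map_poly of_int p) x"] f(1) q0
    by (simp add: poly_of_int_add poly_of_int_mult poly_of_int_smult)
  with deg assms(2) have "r = 0" using nonreal_linear_zero by blast
  with eq have eq: "smult (d ^ k) f = q * s" by simp
  have "content f dvd lead_coeff f" by (rule content_dvd_coeff)
  with f(2) have "content f = 1"
    by (metis is_unit_normalize normalize_content)
  with eq have "content s = d ^ k"
    using assms(3) q(4) by (metis content_mult content_smult abs_of_pos mult_1 mult.right_neutral
        normalize_int_def zero_less_power)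
  then have "smult (d ^ k) f = smult (d ^ k) (q * primitive_part s)"
    using eq by (metis content_times_primitive_part mult_smult_right)
  then have "[:d ^ k:] * f = [:d ^ k:] * (q * primitive_part s)" by simp
  moreover have "[:d ^ k:] \<noteq> 0" using assms(3) by simp
  ultimately have "f = q * primitive_part s" by (metis mult_left_cancel)
  then have "d * lead_coeff (primitive_part s) = 1"
    using f(2) q(3) by (simp add: lead_coeff_mult)
  then show ?thesis using assms(3)
    by (metis dvd_triv_left int_one_le_iff_zero_less order_antisym zdvd_imp_le zero_less_one)
qed

lemma int_adjoin_eisenstein_eq_ring_of_integers:
  "int_adjoin ((1 + csqrt (-3)) / 2) =
    {x \<in> {a + b * csqrt (-3) | a b. a \<in> \<rat> \<and> b \<in> \<rat>}. algebraic_int x}" (is "_ = ?O")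
proof (intro equalityI subsetI)
  define t where "t = csqrt (-3)"
  have t2: "t * t = -3" unfolding t_def by (metis power2_csqrt power2_eq_square)
  have Im_t: "Im t \<noteq> 0" and Re_t: "Re t = 0" by (simp_all add: t_def csqrt_minus3 del: csqrt.simps)
  fix x
  {
    assume "x \<in> int_adjoin ((1 + csqrt (-3)) / 2)"
    then obtain m n where x: "x = of_int m + of_int n * ((1 + t) / 2)"
      unfolding int_adjoin_eisenstein t_def by auto
    have "x = (of_int m + of_int n / 2) + (of_int n / 2) * t"
      unfolding x by (simp add: field_simps)
    moreover have "of_int m + of_int n / 2 \<in> (\<rat> :: complex set)" "of_int n / 2 \<in> (\<rat> :: complex set)"
      by auto
    moreover have "poly (map_poly of_int [:m\<^sup>2 + m * n + n\<^sup>2, - (2 * m + n), 1:]) x = 0"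
      using t2 unfolding x by (simp add: map_poly_pCons field_simps power2_eq_square) algebra
    then have "algebraic_int x"
      unfolding algebraic_int_altdef_ipoly
      by (intro exI[of _ "[:m\<^sup>2 + m * n + n\<^sup>2, - (2 * m + n), 1:]"]) simp
    ultimately show "x \<in> ?O" unfolding t_def by blast
  }
  {
    assume "x \<in> ?O"
    then obtain a b where ab: "a \<in> \<rat>" "b \<in> \<rat>" and x: "x = a + b * t" and int: "algebraic_int x"
      unfolding t_def by auto
    have "\<exists>m n. x = of_int m + of_int n * ((1 + t) / 2)"
    proof (cases "b = 0")
      case True
      with x ab int have "x \<in> \<int>" using rational_algebraic_int_is_int by auto
      then obtain m where "x = of_int m" by (elim Ints_cases)
      then show ?thesis by (intro exI[of _ m] exI[of _ 0]) simp
    next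
      case False
      from ab(1) obtain a1 a2 :: int where a: "a2 > 0" "a = of_int a1 / of_int a2"
        by (elim Rats_cases') auto
      from ab(2) obtain b1 b2 :: int where b: "b2 > 0" "b = of_int b1 / of_int b2"
        by (elim Rats_cases') auto
      define A B D where "A = a1 * b2" and "B = b1 * a2" and "D = a2 * b2"
      have D: "D > 0" "a = of_int A / of_int D" "b = of_int B / of_int D"
        using a b by (auto simp: A_def B_def D_def)
      have "Im a = 0" "Im b = 0" "Re b \<noteq> 0"
        using ab False by (auto simp: D)
      then have Imx: "Im x \<noteq> 0" using Im_t by (simp add: x)
      have Dx: "of_int D * x = of_int A + of_int B * t"
        using D by (simp add: x field_simps)
      have quad: "of_int (D\<^sup>2) * x\<^sup>2 + of_int (- 2 * A * D) * x + of_int (A\<^sup>2 + 3 * B\<^sup>2) = 0"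
        using Dx t2 by simp algebra
      define c where "c = content [:A\<^sup>2 + 3 * B\<^sup>2, - 2 * A * D, D\<^sup>2:]"
      have "c dvd coeff [:A\<^sup>2 + 3 * B\<^sup>2, - 2 * A * D, D\<^sup>2:] i" for i
        unfolding c_def by (rule content_dvd_coeff)
      from this[of 0] this[of 1] this[of 2]
      have "c dvd A\<^sup>2 + 3 * B\<^sup>2" "c dvd - 2 * A * D" "c dvd D\<^sup>2"
        by (simp_all add: numeral_2_eq_2)
      then obtain g e d
        where ged: "A\<^sup>2 + 3 * B\<^sup>2 = c * g" "- 2 * A * D = c * e" "D\<^sup>2 = c * d"
        unfolding dvd_def by blast
      have "c \<noteq> 0" using ged(3) D(1) by auto
      moreover have "normalize c = c" unfolding c_def by (rule normalize_content)
      ultimately have c: "c > 0" by (metis abs_of_pos normalize_int_def zero_less_abs_iff)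
      have "d > 0" using ged(3) D(1) c by (metis zero_less_mult_pos zero_less_power)
      have "smult c [:g, e, d:] = [:A\<^sup>2 + 3 * B\<^sup>2, - 2 * A * D, D\<^sup>2:]"
        by (simp only: ged smult_pCons smult_0_right)
      then have "c = content (smult c [:g, e, d:])" by (simp only: c_def)
      then have "c = c * content [:g, e, d:]" using c by (simp only: content_smult normalize_int_def abs_of_pos)
      then have prim: "content [:g, e, d:] = 1" using c by simp
      have "of_int c * (of_int d * x\<^sup>2 + of_int e * x + of_int g) = 0"
        using quad unfolding ged by (simp add: algebra_simps)
      then have "of_int d * x\<^sup>2 + of_int e * x + of_int g = 0" using c by simp
      with algebraic_int_quadratic[OF int Imx \<open>d > 0\<close> _ prim] have "d = 1" by blast
      with ged have cD: "c = D\<^sup>2" by simp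
      have "D * (D * e) = D * (- 2 * A)"
        using ged(2) unfolding cD power2_eq_square by (simp add: algebra_simps)
      then have A: "D * e = - 2 * A" using D(1) by (simp only: mult_cancel_left) simp
      have "(6 * B)\<^sup>2 = D\<^sup>2 * (3 * (4 * g - e\<^sup>2))"
        using ged(1) A unfolding cD by algebra
      moreover from this have "D dvd 6 * B"
        by (metis dvd_triv_left pow_divides_pow_iff zero_less_numeral)
      then obtain N where N: "6 * B = D * N" by (elim dvdE)
      ultimately have "N\<^sup>2 = 3 * (4 * g - e\<^sup>2)" using D(1) by (simp add: power_mult_distrib)
      moreover from this have "3 dvd N\<^sup>2" by simp
      then have "3 dvd N" by (simp add: prime_dvd_power_iff)
      then obtain n where n: "N = 3 * n" by (elim dvdE)
      ultimately have *: "3 * n\<^sup>2 = 4 * g - e\<^sup>2" by (simp add: power_mult_distrib)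
      then have "even (3 * n\<^sup>2 + e\<^sup>2)" by simp
      then have "even (- e - n)" by (simp add: even_add)
      then obtain m where m: "- e - n = 2 * m" by (elim dvdE)
      have B: "2 * B = D * n" using N n by simp
      have "2 * A = D * (2 * m + n)" using A m by algebra
      with B have "2 * (of_int D * x) = of_int (D * (2 * m + n)) + of_int (D * n) * t"
        unfolding Dx by (metis (no_types, lifting) distrib_left mult.assoc of_int_mult of_int_numeral)
      then have "of_int D * (2 * x) = of_int D * (of_int (2 * m + n) + of_int n * t)"
        by (simp add: algebra_simps)
      then have "2 * x = of_int (2 * m + n) + of_int n * t"
        using D(1) by (simp only: mult_cancel_left) simp
      then have "x = of_int m + of_int n * ((1 + t) / 2)"
        by (simp add: field_simps)
      then show ?thesis by blast
    qed
    then show "x \<in> int_adjoin ((1 + csqrt (-3)) / 2)"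
      unfolding int_adjoin_eisenstein t_def by blast
  }
qed

end

theory Submission
  imports Defs
begin

text \<open>
  Twice an integer can be substituted for each of \<open>x\<^sub>1\<close> and \<open>x\<^sub>2\<close> at no cost: if \<open>x\<^sub>1 = 2a\<close> and
  \<open>x\<^sub>2 = 2b\<close>, then \<open>2x\<^sub>2\<^sup>2 - x\<^sub>1\<^sup>2 = -4m\<close> with \<open>m = a\<^sup>2 - 2b\<^sup>2\<close>, and every multiple of four is a
  difference of two squares, \<open>-4m = (m - 1)\<^sup>2 - (m + 1)\<^sup>2\<close>. So any two distinct non-zero even
  integers extend to a zero of the polynomial, with \<open>z\<^sub>1\<close> and \<open>z\<^sub>2\<close> integers. Of the infinitely
  many positive even integers, two lie in the same cell of any finite partition. The argument
  thus works over every set of complex numbers that contains the integers, and the Eisenstein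
  integers are one such set.
\<close>

lemma pvars_diff: "pvars (p - q) \<subseteq> pvars p \<union> pvars q"
  using keys_diff[of p q] by (auto simp: pvars_def)

lemma pvars_add: "pvars (p + q) \<subseteq> pvars p \<union> pvars q"
  using Poly_Mapping.keys_add[of p q] by (auto simp: pvars_def)

lemma pvars_mult: "pvars (p * q) \<subseteq> pvars p \<union> pvars q"
proof
  fix v assume "v \<in> pvars (p * q)"
  then obtain m n where "m \<in> Poly_Mapping.keys p" "n \<in> Poly_Mapping.keys q"
      "v \<in> Poly_Mapping.keys (m + n)"
    using keys_mult[of p q] by (fastforce simp: pvars_def)
  then show "v \<in> pvars p \<union> pvars q"
    using Poly_Mapping.keys_add[of m n] by (auto simp: pvars_def)
qed

lemma pvars_numeral: "pvars (numeral k) = {}"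
proof -
  have "pvars (of_nat n) = {}" for n
    using pvars_add by (induction n) (fastforce simp: pvars_def)+
  from this[of "numeral k"] show ?thesis by simp
qed

lemma pvars_PVar: "pvars (PVar v) = {v}"
  by (simp add: pvars_def PVar_def)

lemma cpoly_ring_diff:
  "p \<in> cpoly_ring s r \<Longrightarrow> q \<in> cpoly_ring s r \<Longrightarrow> p - q \<in> cpoly_ring s r"
  using pvars_diff[of p q] by (auto simp: cpoly_ring_def)

lemma cpoly_ring_add:
  "p \<in> cpoly_ring s r \<Longrightarrow> q \<in> cpoly_ring s r \<Longrightarrow> p + q \<in> cpoly_ring s r"
  using pvars_add[of p q] by (auto simp: cpoly_ring_def)

lemma cpoly_ring_mult:
  "p \<in> cpoly_ring s r \<Longrightarrow> q \<in> cpoly_ring s r \<Longrightarrow> p * q \<in> cpoly_ring s r"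
  using pvars_mult[of p q] by (auto simp: cpoly_ring_def)

lemma cpoly_ring_numeral: "numeral k \<in> cpoly_ring s r"
  by (simp add: cpoly_ring_def pvars_numeral)

lemma cpoly_ring_X: "i \<in> {1..s} \<Longrightarrow> PVar (X i) \<in> cpoly_ring s r"
  by (simp add: cpoly_ring_def pvars_PVar)

lemma cpoly_ring_Z: "j \<in> {1..r} \<Longrightarrow> PVar (Z j) \<in> cpoly_ring s r"
  by (simp add: cpoly_ring_def pvars_PVar)

lemma infinite_sequence_in_one_cell:
  assumes "finite P" "partition_on R P" "range f \<subseteq> R"
  obtains U where "U \<in> P" "infinite {n :: nat. f n \<in> U}"
proof -
  have "(\<Union>U\<in>P. {n. f n \<in> U}) = UNIV"
    using assms(2,3) by (auto simp: partition_on_def)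
  then have "infinite (\<Union>U\<in>P. {n. f n \<in> U})"
    by simp
  then show ?thesis
    using assms(1) that by auto
qed

text \<open>
  Only even integers are used for \<open>x\<^sub>1\<close> and \<open>x\<^sub>2\<close>: an odd integer \<open>x\<^sub>2\<close> together with an even
  \<open>x\<^sub>1\<close> makes \<open>2x\<^sub>2\<^sup>2 - x\<^sub>1\<^sup>2\<close> congruent to two modulo four, hence no difference of two squares of
  integers.
\<close>

lemma partition_regular_over_superset_Ints:
  assumes "\<int> \<subseteq> R"
  shows "partition_regular_over R 2 2
    ((PVar (X 1))\<^sup>2 - 2 * (PVar (X 2))\<^sup>2 + (PVar (Z 1))\<^sup>2 - (PVar (Z 2))\<^sup>2)" (is "partition_regular_over _ _ _ ?p")
  unfolding partition_regular_over_def
proof (intro conjI allI impI)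
  show "?p \<in> cpoly_ring 2 2"
    unfolding power2_eq_square
    by (intro cpoly_ring_diff cpoly_ring_add cpoly_ring_mult cpoly_ring_numeral
        cpoly_ring_X cpoly_ring_Z) auto
next
  fix P assume P: "finite P \<and> partition_on R P"
  define f :: "nat \<Rightarrow> complex" where "f n = 2 * of_nat (Suc n)" for n
  have "f n \<in> \<int>" for n
    unfolding f_def by (intro Ints_mult Ints_of_nat Ints_numeral)
  then have "range f \<subseteq> R"
    using assms by blast
  with P obtain U where U: "U \<in> P" "infinite {n. f n \<in> U}"
    by (blast elim: infinite_sequence_in_one_cell)
  obtain k where k: "f k \<in> U"
    using not_finite_existsD[OF U(2)] by blast
  obtain l where l: "f l \<in> U" "k < l"
    using U(2) unfolding infinite_nat_iff_unbounded by blast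
  define m :: complex where "m = (of_nat (Suc k))\<^sup>2 - 2 * (of_nat (Suc l))\<^sup>2"
  define x where "x i = (if i = (1 :: nat) then f k else f l)" for i
  define z where "z j = (if j = (1 :: nat) then m - 1 else m + 1)" for j
  have I: "{1..2} = {1, 2 :: nat}" by auto
  have nz: "f n \<noteq> 0" for n
    unfolding f_def by (simp del: of_nat_Suc)
  have ne: "f k \<noteq> f l"
    using l(2) by (simp add: f_def)
  have m: "m \<in> \<int>"
    unfolding m_def by (intro Ints_diff Ints_mult Ints_power Ints_of_nat Ints_numeral)
  have "peval x z ?p = (f k)\<^sup>2 - 2 * (f l)\<^sup>2 + (m - 1)\<^sup>2 - (m + 1)\<^sup>2"
    by (simp add: peval_simps x_def z_def)
  also have "\<dots> = 0"
    unfolding f_def m_def by algebra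
  finally have "peval x z ?p = 0" .
  moreover have "\<forall>i\<in>{1..2}. x i \<in> U \<and> x i \<noteq> 0" "inj_on x {1..2}"
    unfolding I using k l(1) nz ne by (auto simp: x_def)
  moreover have "\<forall>j\<in>{1..2}. z j \<in> R"
    using assms m by (auto simp: z_def)
  ultimately show "\<exists>U\<in>P. \<exists>x z. (\<forall>i\<in>{1..2}. x i \<in> U \<and> x i \<noteq> 0) \<and> inj_on x {1..2} \<and>
      (\<forall>j\<in>{1..2}. z j \<in> R) \<and> peval x z ?p = 0"
    using U(1) by blast
qed

lemma Ints_subset_int_adjoin: "\<int> \<subseteq> int_adjoin \<alpha>"
proof
  fix x :: complex assume "x \<in> \<int>"
  then obtain k where "x = of_int k" by (elim Ints_cases)
  then have "x = poly (map_poly of_int [:k:]) \<alpha>" by (simp add: map_poly_pCons)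
  then show "x \<in> int_adjoin \<alpha>" unfolding int_adjoin_def by blast
qed

theorem corollary1p15:
  shows "partition_regular_over (int_adjoin ((1 + csqrt (-3)) / 2)) 2 2
    ((PVar (X 1))\<^sup>2 - 2 * (PVar (X 2))\<^sup>2 + (PVar (Z 1))\<^sup>2 - (PVar (Z 2))\<^sup>2)"
  by (rule partition_regular_over_superset_Ints[OF Ints_subset_int_adjoin])

end
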